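(* Let $Q$ be a $(d-1)$-dimensional convex polytope and suppose there is a $d$-dimensional convex polytope $P\subset\mathbb{R}^d$ that is a pyramid over a polytope combinatorially equivalent to $Q$ (i.e. $P=\mathrm{conv}(B\cup\{a\})$ with $B$ combinatorially equivalent to $Q$ and $a\notin\mathrm{aff}(B)$) and satisfies $P=-P^\circ$. Then there exists a polytope $S\subset\mathbb{R}^{d-1}$ combinatorially equivalent to $Q$ with $S=-S^\circ$.
   Context: Two polytopes are combinatorially equivalent if their face lattices (faces ordered by inclusion) are isomorphic. For $A\subseteq\mathbb{R}^m$, the polar is $A^\circ=\{x\in\mathbb{R}^m:\langle x,a\rangle\le 1\text{ for all }a\in A\}$, and $-A=\{-a:a\in A\}$. *)

theory Defs
  imports "HOL-Analysis.Analysis"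
begin

(* The faces of a polytope include the empty face and the polytope itself, which both are
   faces in the sense of face_of. A bijection that preserves and reflects inclusion is exactly
   an isomorphism of the face lattices. *)
definition comb_equiv :: "'a::real_vector set \<Rightarrow> 'b::real_vector set \<Rightarrow> bool" where
  "comb_equiv P Q \<longleftrightarrow>
     (\<exists>f. bij_betw f {F. F face_of P} {G. G face_of Q} \<and>
          (\<forall>F F'. F face_of P \<longrightarrow> F' face_of P \<longrightarrow> (F \<subseteq> F' \<longleftrightarrow> f F \<subseteq> f F')))"

(* The polar is taken in the whole type. For a set A inside a linear subspace W, the polar of A
   with respect to the Euclidean space W is W \<inter> polar A. This is how R^m is handled when m may
   be 0: types of class euclidean_space have positive dimension, so R^m is rendered as an
   arbitrary linear subspace W with dim W = m (W = UNIV :: (real^'m) set if m = CARD('m)). *)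
definition polar :: "'a::real_inner set \<Rightarrow> 'a set" where
  "polar A = {x. \<forall>a\<in>A. x \<bullet> a \<le> 1}"

end

theory Submission
  imports Defs
begin

text \<open>
  Write \<open>P = -P\<degree>\<close> as \<open>P = {x. x \<bullet> y \<ge> -1 for all y \<in> P}\<close>. The base \<open>B\<close> is cut out of \<open>P\<close> by some
  \<open>c \<bullet> x = -1\<close> with \<open>c \<in> P\<close>; write \<open>c\<close> as a convex combination of the apex \<open>a\<close> and a point of \<open>B\<close>.
  The weight of \<open>a\<close> is positive, as otherwise \<open>c \<in> B\<close> and \<open>c \<bullet> c = -1\<close>; since both points have inner
  product at least \<open>-1\<close> with each \<open>x \<in> B\<close>, it follows that \<open>a \<bullet> x = -1\<close>. So \<open>B\<close> lies in the
  hyperplane \<open>a \<bullet> x = -1\<close>. Moving it along \<open>a\<close> into the hyperplane orthogonal to \<open>a\<close> raises every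
  inner product by \<open>1 / (a \<bullet> a)\<close>, so a rescaling by \<open>1 / sqrt (1 + 1 / (a \<bullet> a))\<close> restores
  the bound \<open>-1\<close>.
\<close>

section \<open>Combinatorial equivalence and injective affine maps\<close>

lemma comb_equiv_trans:
  assumes "comb_equiv P Q" "comb_equiv Q R"
  shows "comb_equiv P R"
proof -
  obtain f where f: "bij_betw f {F. F face_of P} {G. G face_of Q}"
    "\<And>F F'. F face_of P \<Longrightarrow> F' face_of P \<Longrightarrow> F \<subseteq> F' \<longleftrightarrow> f F \<subseteq> f F'"
    using assms(1) unfolding comb_equiv_def by auto
  obtain g where g: "bij_betw g {F. F face_of Q} {G. G face_of R}"
    "\<And>F F'. F face_of Q \<Longrightarrow> F' face_of Q \<Longrightarrow> F \<subseteq> F' \<longleftrightarrow> g F \<subseteq> g F'"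
    using assms(2) unfolding comb_equiv_def by auto
  have "f F face_of Q" if "F face_of P" for F
    using bij_betw_apply[OF f(1)] that by auto
  then have "\<forall>F F'. F face_of P \<longrightarrow> F' face_of P \<longrightarrow> (F \<subseteq> F' \<longleftrightarrow> (g \<circ> f) F \<subseteq> (g \<circ> f) F')"
    using f(2) g(2) by simp
  then show ?thesis
    unfolding comb_equiv_def using bij_betw_trans[OF f(1) g(1)] by blast
qed

lemma comb_equiv_sym:
  assumes "comb_equiv P Q"
  shows "comb_equiv Q P"
proof -
  obtain f where f: "bij_betw f {F. F face_of P} {G. G face_of Q}"
    "\<And>F F'. F face_of P \<Longrightarrow> F' face_of P \<Longrightarrow> F \<subseteq> F' \<longleftrightarrow> f F \<subseteq> f F'"
    using assms unfolding comb_equiv_def by auto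
  let ?h = "inv_into {F. F face_of P} f"
  have h: "bij_betw ?h {F. F face_of Q} {F. F face_of P}"
    by (rule bij_betw_inv_into[OF f(1)])
  have "?h G face_of P" if "G face_of Q" for G
    using bij_betw_apply[OF h] that by auto
  moreover have "f (?h G) = G" if "G face_of Q" for G
    using bij_betw_inv_into_right[OF f(1)] that by auto
  ultimately have "\<forall>F F'. F face_of Q \<longrightarrow> F' face_of Q \<longrightarrow> (F \<subseteq> F' \<longleftrightarrow> ?h F \<subseteq> ?h F')"
    using f(2) by simp
  then show ?thesis
    unfolding comb_equiv_def using h by blast
qed

text \<open>Affine maps send segments to segments, and injectivity keeps open segments
  nondegenerate, so the face condition passes both ways. Injectivity is asked only on
  \<open>S\<close> because the map applied later is controlled only on one hyperplane.\<close>

lemma comb_equiv_affine_image: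
  fixes f :: "'a::real_vector \<Rightarrow> 'b::real_vector"
  assumes "convex S" and inj: "inj_on f S"
    and aff: "\<And>u x y. f ((1 - u) *\<^sub>R x + u *\<^sub>R y) = (1 - u) *\<^sub>R f x + u *\<^sub>R f y"
  shows "comb_equiv S (f ` S)"
proof -
  have face_image: "f ` F face_of f ` S" if F: "F face_of S" for F
    unfolding face_of_def
  proof (intro conjI ballI impI)
    have FS: "F \<subseteq> S" by (rule face_of_imp_subset[OF F])
    show "f ` F \<subseteq> f ` S" using FS by blast
    show "convex (f ` F)"
      using face_of_imp_convex[OF F]
      by (force simp: convex_alt aff[symmetric])
    fix p q r
    assume "p \<in> f ` S" "q \<in> f ` S" "r \<in> f ` F" and r: "r \<in> open_segment p q"
    then obtain x y z where xyz: "x \<in> S" "p = f x" "y \<in> S" "q = f y" "z \<in> F" "r = f z"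
      by blast
    obtain u where u: "0 < u" "u < 1" "r = (1 - u) *\<^sub>R p + u *\<^sub>R q" and "p \<noteq> q"
      using r by (auto simp: in_segment)
    \<comment> \<open>The candidate preimage of \<open>r\<close> has to lie in \<open>S\<close>
      before injectivity can identify it with \<open>z\<close>.\<close>
    have "(1 - u) *\<^sub>R x + u *\<^sub>R y \<in> S"
      using \<open>convex S\<close> xyz u by (simp add: convex_alt)
    moreover have "f z = f ((1 - u) *\<^sub>R x + u *\<^sub>R y)"
      using u xyz by (simp add: aff)
    ultimately have "z = (1 - u) *\<^sub>R x + u *\<^sub>R y"
      using inj xyz FS by (meson inj_onD subsetD)
    then have "z \<in> open_segment x y"
      using u xyz \<open>p \<noteq> q\<close> by (auto simp: in_segment)
    then have "x \<in> F \<and> y \<in> F"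
      using F xyz by (auto simp: face_of_def)
    then show "p \<in> f ` F" "q \<in> f ` F" using xyz by auto
  qed
  have face_preimage: "{x \<in> S. f x \<in> G} face_of S" if G: "G face_of f ` S" for G
    unfolding face_of_def
  proof (intro conjI ballI impI)
    show "{x \<in> S. f x \<in> G} \<subseteq> S" by blast
    show "convex {x \<in> S. f x \<in> G}"
      using face_of_imp_convex[OF G] \<open>convex S\<close> by (simp add: convex_alt aff)
    fix x y z
    assume xyz: "x \<in> S" "y \<in> S" "z \<in> {x \<in> S. f x \<in> G}" and z: "z \<in> open_segment x y"
    have "f x \<noteq> f y"
      using z inj xyz by (auto simp: in_segment dest: inj_onD)
    then have "f z \<in> open_segment (f x) (f y)"
      using z by (auto simp: in_segment aff)
    then have "f x \<in> G \<and> f y \<in> G"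
      using G xyz unfolding face_of_def by blast
    then show "x \<in> {x \<in> S. f x \<in> G}" "y \<in> {x \<in> S. f x \<in> G}" using xyz by auto
  qed
  have "bij_betw ((`) f) {F. F face_of S} {G. G face_of f ` S}"
  proof (rule bij_betw_byWitness[where f' = "\<lambda>G. {x \<in> S. f x \<in> G}"])
    show "\<forall>F\<in>{F. F face_of S}. {x \<in> S. f x \<in> f ` F} = F"
      using inj by (auto dest!: face_of_imp_subset dest: inj_onD)
    show "\<forall>G\<in>{G. G face_of f ` S}. f ` {x \<in> S. f x \<in> G} = G"
      by (auto dest!: face_of_imp_subset)
  qed (use face_image face_preimage in auto)
  moreover have "\<forall>F F'. F face_of S \<longrightarrow> F' face_of S \<longrightarrow> (F \<subseteq> F' \<longleftrightarrow> f ` F \<subseteq> f ` F')"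
    using inj_on_image_subset_iff[OF inj] face_of_imp_subset by metis
  ultimately show ?thesis
    unfolding comb_equiv_def by blast
qed

section \<open>The base of a pyramid equal to its negated polar\<close>

lemma mem_uminus_polar_iff: "x \<in> uminus ` polar A \<longleftrightarrow> (\<forall>y\<in>A. x \<bullet> y \<ge> -1)"
proof
  show "x \<in> uminus ` polar A" if "\<forall>y\<in>A. x \<bullet> y \<ge> -1"
    using that by (intro image_eqI[of _ _ "-x"]) (auto simp: polar_def)
qed (auto simp: polar_def)

text \<open>The equality, rather than an inclusion, later lets points of the hyperplane that pass
  the polar test be recognised as points of \<open>B\<close>; nonemptiness gives
  \<open>a \<noteq> 0\<close>.\<close>

lemma pyramid_neg_self_polar_base:
  fixes P B :: "'a::euclidean_space set"
  assumes "bounded P" "convex B" "aff_dim P = DIM('a)" "a \<notin> affine hull B"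
    and P: "P = convex hull (B \<union> {a})" and polar: "P = uminus ` polar P"
  shows "B \<noteq> {}" and "B = {x \<in> P. a \<bullet> x = -1}"
proof -
  have mem_P: "x \<in> P \<longleftrightarrow> (\<forall>y\<in>P. x \<bullet> y \<ge> -1)" for x
    using mem_uminus_polar_iff[of x P] unfolding polar[symmetric] .
  have "aff_dim B = DIM('a) - 1"
    using assms(3,4) by (simp add: P aff_dim_convex_hull aff_dim_insert)
  then obtain n\<^sub>0 \<beta>\<^sub>0 where n\<^sub>0: "n\<^sub>0 \<noteq> 0" "affine hull B = {x. n\<^sub>0 \<bullet> x = \<beta>\<^sub>0}"
    using aff_dim_eq_hyperplane[of B] by (auto simp: of_nat_diff)
  \<comment> \<open>The empty set has affine dimension -1, while \<open>DIM('a) - 1\<close> is at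
    least 0.\<close>
  show "B \<noteq> {}"
    using \<open>aff_dim B = DIM('a) - 1\<close> DIM_positive[where 'a='a] by auto
  \<comment> \<open>The normal is oriented so that the apex lies strictly on its positive
    side.\<close>
  have "\<exists>n \<beta>. n \<noteq> 0 \<and> (\<forall>x\<in>B. n \<bullet> x = \<beta>) \<and> n \<bullet> a > \<beta>"
  proof (cases "n\<^sub>0 \<bullet> a > \<beta>\<^sub>0")
    case True
    then show ?thesis using n\<^sub>0 hull_subset[of B affine] by blast
  next
    case False
    then have "-n\<^sub>0 \<bullet> a > -\<beta>\<^sub>0" using n\<^sub>0 assms(4) by auto
    moreover have "\<forall>x\<in>B. -n\<^sub>0 \<bullet> x = -\<beta>\<^sub>0" using n\<^sub>0 hull_subset[of B affine] by auto
    ultimately show ?thesis using n\<^sub>0(1) neg_equal_0_iff_equal by blast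
  qed
  then obtain n \<beta> where n: "n \<noteq> 0" "\<And>x. x \<in> B \<Longrightarrow> n \<bullet> x = \<beta>" "n \<bullet> a > \<beta>"
    by blast
  have P_eq: "P = {u *\<^sub>R a + v *\<^sub>R b |u v b. 0 \<le> u \<and> 0 \<le> v \<and> u + v = 1 \<and> b \<in> B}"
    using \<open>B \<noteq> {}\<close> \<open>convex B\<close> by (auto simp: P convex_hull_insert hull_same)
  have n_ge: "n \<bullet> x \<ge> \<beta>" if x: "x \<in> P" for x
  proof -
    have "convex {x. n \<bullet> x \<ge> \<beta>}" by (rule convex_halfspace_ge)
    moreover have "B \<union> {a} \<subseteq> {x. n \<bullet> x \<ge> \<beta>}" using n by auto
    ultimately have "P \<subseteq> {x. n \<bullet> x \<ge> \<beta>}" unfolding P by (rule hull_minimal[rotated])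
    then show ?thesis using x by blast
  qed
  have "0 \<in> P" using mem_P[of 0] by simp
  then have "\<beta> \<le> 0" using n_ge by fastforce
  \<comment> \<open>Otherwise \<open>n\<close> is nonnegative on \<open>P\<close>, so the whole ray
    spanned by \<open>n\<close> passes the membership test, and its point of norm
    \<open>M + 1\<close> violates the bound.\<close>
  moreover have "\<beta> \<noteq> 0"
  proof
    assume "\<beta> = 0"
    then have ray: "t *\<^sub>R n \<in> P" if "t \<ge> 0" for t
      using that n_ge mem_P[of "t *\<^sub>R n"]
      by (smt (verit) inner_scaleR_left mult_nonneg_nonneg)
    obtain M where M: "\<And>x. x \<in> P \<Longrightarrow> norm x \<le> M" and "M > 0"
      using \<open>bounded P\<close> bounded_pos by blast
    have "norm (((M + 1) / norm n) *\<^sub>R n) \<le> M"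
      using \<open>M > 0\<close> by (intro M ray) auto
    then show False using \<open>M > 0\<close> n(1) by simp
  qed
  ultimately have "\<beta> < 0" by simp
  \<comment> \<open>Scaled so that the inequality \<open>n \<bullet> x \<ge> \<beta>\<close> becomes
    exactly the membership test for \<open>c\<close>, with equality on \<open>B\<close>.\<close>
  define c where "c = (1 / (- \<beta>)) *\<^sub>R n"
  have c_B: "c \<bullet> x = -1" if "x \<in> B" for x
    using n(2)[OF that] \<open>\<beta> < 0\<close> by (simp add: c_def)
  have "c \<bullet> x \<ge> -1" if "x \<in> P" for x
    using n_ge[OF that] \<open>\<beta> < 0\<close> by (simp add: c_def field_simps)
  then have "c \<in> P" using mem_P by blast
  then obtain u v b where c: "c = u *\<^sub>R a + v *\<^sub>R b" "0 \<le> u" "0 \<le> v" "u + v = 1" "b \<in> B"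
    unfolding P_eq by blast
  have "u \<noteq> 0"
  proof
    assume "u = 0"
    then have "c \<in> B" using c by simp
    then show False using c_B[of c] inner_ge_zero[of c] by linarith
  qed
  have "B \<subseteq> P" "a \<in> P" unfolding P using hull_subset[of "B \<union> {a}" convex] by auto
  have a_B: "a \<bullet> x = -1" if x: "x \<in> B" for x
  proof -
    have "a \<bullet> x \<ge> -1" "b \<bullet> x \<ge> -1"
      using mem_P \<open>B \<subseteq> P\<close> \<open>a \<in> P\<close> c(5) x by blast+
    moreover have "u * (a \<bullet> x) + v * (b \<bullet> x) = -1"
      using c_B[OF x] by (simp add: c(1) inner_add_left)
    then have "u * (a \<bullet> x + 1) + v * (b \<bullet> x + 1) = 0"
      using c(4) by (simp add: algebra_simps)
    ultimately have "u * (a \<bullet> x + 1) = 0"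
      using c(2,3) add_nonneg_eq_0_iff[of "u * (a \<bullet> x + 1)" "v * (b \<bullet> x + 1)"] by simp
    then show ?thesis using \<open>u \<noteq> 0\<close> by simp
  qed
  show "B = {x \<in> P. a \<bullet> x = -1}"
  proof
    show "B \<subseteq> {x \<in> P. a \<bullet> x = -1}" using a_B \<open>B \<subseteq> P\<close> by blast
    show "{x \<in> P. a \<bullet> x = -1} \<subseteq> B"
    proof clarify
      fix x
      assume "x \<in> P" and ax: "a \<bullet> x = -1"
      then obtain s t y where x: "x = s *\<^sub>R a + t *\<^sub>R y" "s + t = 1" "y \<in> B"
        unfolding P_eq by blast
      \<comment> \<open>As \<open>a \<bullet> a + 1\<close> is positive, this forces the apex weight
        \<open>s\<close> to vanish.\<close>
      have "s * (a \<bullet> a) - t = -1"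
        using ax a_B[OF x(3)] by (simp add: x(1) inner_add_right)
      then have "s * (a \<bullet> a + 1) = 0"
        using x(2) by (simp add: algebra_simps)
      then have "s = 0" using inner_ge_zero[of a] by auto
      then show "x \<in> B" using x by simp
    qed
  qed
qed

section \<open>Transport of the base into \<open>W\<close>\<close>

theorem theorem5p5:
  fixes d :: nat
    and Q :: "'q::euclidean_space set"
    and P B :: "(real^'n) set"
    and a :: "real^'n"
    and W :: "'w::euclidean_space set"
  assumes "polytope Q" and "aff_dim Q = int d - 1"
    and "CARD('n) = d"
    and "polytope P" and "aff_dim P = int d"
    and "polytope B" and "comb_equiv B Q"
    and "a \<notin> affine hull B" and "P = convex hull (B \<union> {a})"
    and "P = uminus ` polar P"
    and "subspace W" and "dim W + 1 = d"
  shows "\<exists>S. S \<subseteq> W \<and> polytope S \<and> comb_equiv S Q \<and> S = uminus ` (W \<inter> polar S)"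
proof -
  have "convex B" using \<open>polytope B\<close> by (rule polytope_imp_convex)
  have "B \<noteq> {}" and B: "B = {x \<in> P. a \<bullet> x = -1}"
    using pyramid_neg_self_polar_base[OF polytope_imp_bounded[OF assms(4)] \<open>convex B\<close> _ assms(8-10)]
      assms(3,5) by auto
  have mem_P: "x \<in> P \<longleftrightarrow> (\<forall>y\<in>P. x \<bullet> y \<ge> -1)" for x
    using mem_uminus_polar_iff[of x P] unfolding assms(10)[symmetric] .
  have "a \<noteq> 0" using \<open>B \<noteq> {}\<close> B by auto
  define V where "V = {x. a \<bullet> x = 0}"
  have "subspace V" unfolding V_def by (rule subspace_hyperplane)
  moreover have "dim V = dim W"
    using \<open>a \<noteq> 0\<close> assms(3,12) by (simp add: V_def dim_hyperplane)
  ultimately obtain f g where "linear f" and fV: "f ` V = W" and gW: "g ` W = V"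
    and norm_f: "\<And>x. x \<in> V \<Longrightarrow> norm (f x) = norm x"
    and fg: "\<And>x. x \<in> W \<Longrightarrow> f (g x) = x"
    using isometries_subspaces[OF _ \<open>subspace W\<close>] by metis
  interpret f: linear f by fact
  have inner_f: "f x \<bullet> f y = x \<bullet> y" if "x \<in> V" "y \<in> V" for x y
    using that subspace_add[OF \<open>subspace V\<close>]
    by (simp add: dot_norm norm_f flip: f.add)
  \<comment> \<open>Adding \<open>r *\<^sub>R a\<close> carries the hyperplane
    \<open>a \<bullet> x = -1\<close> onto \<open>V\<close>.\<close>
  define r where "r = 1 / (a \<bullet> a)"
  have "r > 0" using \<open>a \<noteq> 0\<close> by (simp add: r_def)
  have r_a: "a \<bullet> (r *\<^sub>R a) = 1" using \<open>a \<noteq> 0\<close> by (simp add: r_def)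
  \<comment> \<open>The translation lowers the critical value -1 to \<open>-1 - r\<close>; the
    factor \<open>k * k\<close> brings it back to -1.\<close>
  define k where "k = 1 / sqrt (1 + r)"
  have "k > 0" and k2: "k * k * (1 + r) = 1"
    using \<open>r > 0\<close> by (auto simp: k_def)
  define m where "m x = k *\<^sub>R f (x + r *\<^sub>R a)" for x
  have mV: "x + r *\<^sub>R a \<in> V \<longleftrightarrow> a \<bullet> x = -1" for x
    using r_a by (auto simp: V_def inner_add_right)
  have inner_m: "m x \<bullet> m y = k * k * (x \<bullet> y - r)" if "a \<bullet> x = -1" "a \<bullet> y = -1" for x y
  proof -
    have "m x \<bullet> m y = k * k * ((x + r *\<^sub>R a) \<bullet> (y + r *\<^sub>R a))"
      using that mV by (simp add: m_def inner_f)
    \<comment> \<open>The cross terms contribute \<open>-2 * r\<close> and the square of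
      \<open>r *\<^sub>R a\<close> contributes \<open>r\<close>, so inner products fall by
      \<open>r\<close>.\<close>
    also have "(x + r *\<^sub>R a) \<bullet> (y + r *\<^sub>R a) = x \<bullet> y - r"
      using that r_a by (simp add: inner_add_left inner_add_right inner_commute)
    finally show ?thesis .
  qed
  have m_ge_iff: "m x \<bullet> m y \<ge> -1 \<longleftrightarrow> x \<bullet> y \<ge> -1" if "a \<bullet> x = -1" "a \<bullet> y = -1" for x y
  proof -
    have "m x \<bullet> m y + 1 = k * k * (x \<bullet> y + 1)"
      using k2 by (simp add: inner_m[OF that] algebra_simps)
    moreover have "k * k * (x \<bullet> y + 1) \<ge> 0 \<longleftrightarrow> x \<bullet> y + 1 \<ge> 0"
      using \<open>k > 0\<close> by (simp add: zero_le_mult_iff mult_le_0_iff)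
    ultimately show ?thesis by linarith
  qed
  have m_W: "m x \<in> W" if "a \<bullet> x = -1" for x
    using that mV fV \<open>subspace W\<close> by (auto simp: m_def intro: subspace_scale)
  have m_surj: "\<exists>x. a \<bullet> x = -1 \<and> m x = w" if "w \<in> W" for w
  proof (intro exI conjI)
    \<comment> \<open>Inverts \<open>m\<close>: undo the scaling, return to \<open>V\<close> by
      \<open>g\<close>, translate back.\<close>
    let ?x = "g ((1 / k) *\<^sub>R w) - r *\<^sub>R a"
    have w: "(1 / k) *\<^sub>R w \<in> W" using that \<open>subspace W\<close> by (rule subspace_scale[rotated])
    then show "a \<bullet> ?x = -1" using gW mV[of ?x] by auto
    show "m ?x = w" using fg[OF w] \<open>k > 0\<close> by (simp add: m_def)
  qed
  have inj: "inj_on m B"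
  proof (rule inj_onI)
    fix x y
    assume xy: "x \<in> B" "y \<in> B" "m x = m y"
    then have "f (x - y) = 0" using \<open>k > 0\<close> by (simp add: m_def f.add f.diff)
    moreover have "x - y \<in> V" using xy B by (auto simp: V_def inner_diff_right)
    ultimately show "x = y" using norm_f by fastforce
  qed
  have aff: "m ((1 - u) *\<^sub>R x + u *\<^sub>R y) = (1 - u) *\<^sub>R m x + u *\<^sub>R m y" for u x y
    by (simp add: m_def f.add f.diff f.scale algebra_simps)
  have "comb_equiv (m ` B) Q"
    using comb_equiv_sym[OF comb_equiv_affine_image[OF \<open>convex B\<close> inj aff]] assms(7)
    by (rule comb_equiv_trans)
  moreover have "polytope (m ` B)"
  proof -
    have "m ` B = (\<lambda>x. k *\<^sub>R f x) ` ((+) (r *\<^sub>R a) ` B)"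
      by (simp add: m_def image_image add.commute)
    moreover have "linear (\<lambda>x. k *\<^sub>R f x)" by (simp add: linear_compose_scale_right f.linear_axioms)
    ultimately show ?thesis
      using \<open>polytope B\<close> by (simp add: polytope_linear_image polytope_translation_eq)
  qed
  moreover have "m ` B \<subseteq> W" using B m_W by auto
  moreover have "m ` B = uminus ` (W \<inter> polar (m ` B))"
  proof -
    \<comment> \<open>On this hyperplane the test against the apex holds with equality, and a
      half-space containing \<open>B\<close> and \<open>a\<close> contains their hull; testing
      against \<open>B\<close> therefore suffices.\<close>
    have ge_P_iff: "x \<in> P \<longleftrightarrow> (\<forall>y\<in>B. x \<bullet> y \<ge> -1)" if "a \<bullet> x = -1" for x
    proof
      assume x: "\<forall>y\<in>B. x \<bullet> y \<ge> -1"
      have "B \<union> {a} \<subseteq> {y. x \<bullet> y \<ge> -1}" using x that by (auto simp: inner_commute)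
      then have "P \<subseteq> {y. x \<bullet> y \<ge> -1}"
        unfolding assms(9) using convex_halfspace_ge by (rule hull_minimal)
      then show "x \<in> P" using mem_P by blast
    qed (use mem_P B in blast)
    have "w \<in> m ` B \<longleftrightarrow> w \<in> uminus ` (W \<inter> polar (m ` B))" for w
    proof (cases "w \<in> W")
      case True
      then obtain x where x: "a \<bullet> x = -1" "m x = w" using m_surj by blast
      have "w \<in> m ` B \<longleftrightarrow> (\<forall>y\<in>B. w \<bullet> m y \<ge> -1)"
      proof
        assume "w \<in> m ` B"
        then obtain z where z: "z \<in> B" "w = m z" by blast
        then have "z \<bullet> y \<ge> -1" if "y \<in> B" for y
          using ge_P_iff[of z] that B by blast
        then show "\<forall>y\<in>B. w \<bullet> m y \<ge> -1"
          using m_ge_iff z B by auto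
      next
        assume "\<forall>y\<in>B. w \<bullet> m y \<ge> -1"
        \<comment> \<open>The test is pulled back through \<open>m\<close>, which preserves the
          threshold -1; passing it puts \<open>x\<close> in \<open>P\<close>, hence in
          \<open>B\<close>.\<close>
        then have "\<forall>y\<in>B. x \<bullet> y \<ge> -1" using m_ge_iff x B by auto
        then have "x \<in> B" using ge_P_iff x B by blast
        then show "w \<in> m ` B" using x by blast
      qed
      also have "\<dots> \<longleftrightarrow> w \<in> uminus ` polar (m ` B)"
        by (simp add: mem_uminus_polar_iff)
      \<comment> \<open>\<open>W\<close> is closed under negation, so intersecting with it before
        negating changes nothing for \<open>w\<close> in \<open>W\<close>.\<close>
      also have "\<dots> \<longleftrightarrow> w \<in> uminus ` (W \<inter> polar (m ` B))"
        using True subspace_neg[OF \<open>subspace W\<close>] by force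
      finally show ?thesis .
    next
      case False
      then show ?thesis
        using \<open>m ` B \<subseteq> W\<close> subspace_neg[OF \<open>subspace W\<close>] by auto
    qed
    then show ?thesis by blast
  qed
  ultimately show ?thesis by blast
qed

end
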